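(* Let $\theta_1,\theta_2>0$. Let $\mathcal{P}_1$ and $\mathcal{P}_2$ be two regular parametric families of probability densities, with parameter spaces $\Theta_1,\Theta_2$ and Fisher information metrics $g_1,g_2$. Let $f_{1,D}\in\mathcal{P}_1$ and $f_{2,D}\in\mathcal{P}_2$ (for each dataset $D$) be random mechanisms such that $f_{1,D}$ satisfies $\theta_1$-Rao differential privacy and $f_{2,D}$ satisfies $\theta_2$-Rao differential privacy. Then the composed mechanism $D\mapsto f_{1,D}\times f_{2,D}$ (the product density), regarded as an element of the product family $\mathcal{P}_1\times\mathcal{P}_2$, satisfies $\sqrt{\theta_1^2+\theta_2^2}$-Rao differential privacy.
   Context: Datasets: $D=\{x_1,\dots,x_n\}$ with $x_i\in\mathcal{X}$ and $n$ fixed. Two datasets $D,D'$ are adjacent, written $D\sim D'$, if $|D|=|D'|$ and they differ in exactly one observation. A random mechanism assigns to each dataset $D$ a probability density $f_D$. Rao distance: let $\mathcal{P}=\{p(\cdot;\vartheta):\vartheta\in\Theta\}$ be a parametric family of densities with respect to a base measure, identified with its parameter space, where $\Theta\subset\mathbb{R}^k$ is open and connected. The family is regular if: the partial derivatives $\partial p(x;\vartheta)/\partial\vartheta_i$ exist almost everywhere; integration and differentiation can be interchanged, so that $\int \partial p(x;\vartheta)/\partial\vartheta_i\,dx=0$; the support of $p(\cdot;\vartheta)$ does not depend on $\vartheta$; and the Fisher information matrix $$g_{ij}(\vartheta)=\mathbb{E}_{x\sim p(\cdot;\vartheta)}\left[\frac{\partial \ln p(x;\vartheta)}{\partial\vartheta_i}\frac{\partial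 \ln p(x;\vartheta)}{\partial\vartheta_j}\right]$$ is symmetric positive definite and varies smoothly with $\vartheta$, so that it is a Riemannian metric on $\Theta$. The Rao distance $d_R(p(\cdot;\vartheta_1),p(\cdot;\vartheta_2))$ is the Riemannian distance between $\vartheta_1$ and $\vartheta_2$ in $(\Theta,g)$, i.e. the infimum of $\int_0^1\big(\sum_{i,j}g_{ij}(\alpha(t))\dot\alpha_i(t)\dot\alpha_j(t)\big)^{1/2}dt$ over smooth paths $\alpha:[0,1]\to\Theta$ with $\alpha(0)=\vartheta_1$, $\alpha(1)=\vartheta_2$. Product family: $\mathcal{P}_1\times\mathcal{P}_2$ consists of the product densities $(p_1\times p_2)(x,y)=p_1(x)p_2(y)$, $p_i\in\mathcal{P}_i$. It has parameter space $\Theta_1\times\Theta_2$ and carries the block-diagonal metric $\begin{pmatrix}g_1&0\\0&g_2\end{pmatrix}$; its Rao distance is the Riemannian distance of this metric. Rao differential privacy: for $\theta>0$, a mechanism $f_D$ with values in a parametric family satisfies $\theta$-Rao differential privacy if $d_R(f_D,f_{D'})\le\theta$ for all $D\sim D'$. *)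

theory Defs
  imports "HOL-Analysis.Analysis"
begin

definition datasets :: "'x set \<Rightarrow> nat \<Rightarrow> 'x list set" where
  "datasets X n = {D \<in> lists X. length D = n}"

definition adjacent :: "'x list \<Rightarrow> 'x list \<Rightarrow> bool" where
  "adjacent D D' \<longleftrightarrow> length D = length D' \<and> (\<exists>!i. i < length D \<and> D ! i \<noteq> D' ! i)"

text \<open>
  The derivatives are taken within \<open>S\<close>. For open \<open>S\<close> these are the ordinary derivatives; for
  \<open>S = {0..1}\<close> they are one-sided at the end points. In both cases (the only ones used below)
  they are uniquely determined, and the definition is that of a \<open>C\<^sup>n\<close> function.
\<close>

primrec Ck_on :: "nat \<Rightarrow> 'a::real_normed_vector set \<Rightarrow> ('a \<Rightarrow> 'b::real_normed_vector) \<Rightarrow> bool" where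
  "Ck_on 0 S f \<longleftrightarrow> continuous_on S f"
| "Ck_on (Suc n) S f \<longleftrightarrow>
     f differentiable_on S \<and> (\<forall>v. Ck_on n S (\<lambda>x. frechet_derivative f (at x within S) v))"

definition smooth_on :: "'a::real_normed_vector set \<Rightarrow> ('a \<Rightarrow> 'b::real_normed_vector) \<Rightarrow> bool" where
  "smooth_on S f \<longleftrightarrow> (\<forall>n. Ck_on n S f)"

definition smooth_paths :: "(real^'k) set \<Rightarrow> real^'k \<Rightarrow> real^'k \<Rightarrow> (real \<Rightarrow> real^'k) set" where
  "smooth_paths \<Theta> a b =
     {\<alpha>. smooth_on {0..1} \<alpha> \<and> \<alpha> ` {0..1} \<subseteq> \<Theta> \<and> \<alpha> 0 = a \<and> \<alpha> 1 = b}"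

definition riemannian_length :: "(real^'k \<Rightarrow> real^'k^'k) \<Rightarrow> (real \<Rightarrow> real^'k) \<Rightarrow> real" where
  "riemannian_length g \<alpha> =
     integral {0..1} (\<lambda>t. let \<alpha>' = vector_derivative \<alpha> (at t within {0..1}) in
       sqrt (\<Sum>i\<in>UNIV. \<Sum>j\<in>UNIV. g (\<alpha> t) $ i $ j * \<alpha>' $ i * \<alpha>' $ j))"

text \<open>
  A real infimum: for open connected \<open>\<Theta>\<close> any two points of \<open>\<Theta>\<close> are joined by a smooth path,
  so the infimum is over a nonempty set.
\<close>

definition riemannian_dist ::
    "(real^'k) set \<Rightarrow> (real^'k \<Rightarrow> real^'k^'k) \<Rightarrow> real^'k \<Rightarrow> real^'k \<Rightarrow> real" where
  "riemannian_dist \<Theta> g a b = (INF \<alpha>\<in>smooth_paths \<Theta> a b. riemannian_length g \<alpha>)"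

text \<open>
  A parametric family is given by a base measure \<open>M\<close>, a parameter space \<open>\<Theta>\<close> and a
  parametrisation \<open>p\<close>, so that \<open>p \<theta> x\<close> is the value at \<open>x\<close> of the density with parameter \<open>\<theta>\<close>;
  as a set of densities it is \<open>p ` \<Theta>\<close>.
\<close>

definition prob_density :: "'a measure \<Rightarrow> ('a \<Rightarrow> real) \<Rightarrow> bool" where
  "prob_density M f \<longleftrightarrow>
     f \<in> borel_measurable M \<and> (\<forall>x\<in>space M. 0 \<le> f x) \<and> has_bochner_integral M f 1"

definition partial :: "'k \<Rightarrow> (real^'k::finite \<Rightarrow> real) \<Rightarrow> real^'k \<Rightarrow> real" where
  "partial i F \<theta> = deriv (\<lambda>t. F (\<theta> + t *\<^sub>R axis i 1)) 0"

definition score :: "(real^'k \<Rightarrow> 'a \<Rightarrow> real) \<Rightarrow> real^'k \<Rightarrow> 'k::finite \<Rightarrow> 'a \<Rightarrow> real" where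
  "score p \<theta> i x = partial i (\<lambda>\<eta>. ln (p \<eta> x)) \<theta>"

definition fisher_info :: "'a measure \<Rightarrow> (real^'k \<Rightarrow> 'a \<Rightarrow> real) \<Rightarrow> real^'k \<Rightarrow> real^'k^'k" where
  "fisher_info M p \<theta> = (\<chi> i j.
     \<integral>x. score p \<theta> i x * score p \<theta> j x \<partial>(density M (\<lambda>x. ennreal (p \<theta> x))))"

text \<open>
  Injectivity of \<open>p\<close> on \<open>\<Theta>\<close> expresses that the family is identified with its parameter space.
  The integrability of the products of scores says that the expectations defining the Fisher
  information exist (a Bochner integral of a non-integrable function is \<open>0\<close> by convention).
\<close>

definition regular_family ::
    "'a measure \<Rightarrow> (real^'k) set \<Rightarrow> (real^'k \<Rightarrow> 'a \<Rightarrow> real) \<Rightarrow> bool" where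
  "regular_family M \<Theta> p \<longleftrightarrow>
     open \<Theta> \<and> connected \<Theta> \<and> inj_on p \<Theta> \<and>
     (\<forall>\<theta>\<in>\<Theta>. prob_density M (p \<theta>)) \<and>
     (\<forall>\<theta>\<in>\<Theta>. \<forall>i. AE x in M. (\<lambda>t. p (\<theta> + t *\<^sub>R axis i 1) x) differentiable (at 0)) \<and>
     (\<forall>\<theta>\<in>\<Theta>. \<forall>i. integrable M (\<lambda>x. partial i (\<lambda>\<eta>. p \<eta> x) \<theta>) \<and>
        ((\<lambda>t. \<integral>x. p (\<theta> + t *\<^sub>R axis i 1) x \<partial>M) has_real_derivative
           (\<integral>x. partial i (\<lambda>\<eta>. p \<eta> x) \<theta> \<partial>M)) (at 0)) \<and>
     (\<forall>\<theta>\<in>\<Theta>. \<forall>\<eta>\<in>\<Theta>. {x \<in> space M. p \<theta> x \<noteq> 0} = {x \<in> space M. p \<eta> x \<noteq> 0}) \<and>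
     (\<forall>\<theta>\<in>\<Theta>. \<forall>i j. integrable (density M (\<lambda>x. ennreal (p \<theta> x)))
        (\<lambda>x. score p \<theta> i x * score p \<theta> j x)) \<and>
     (\<forall>\<theta>\<in>\<Theta>. transpose (fisher_info M p \<theta>) = fisher_info M p \<theta> \<and>
        (\<forall>v. v \<noteq> 0 \<longrightarrow> 0 < v \<bullet> (fisher_info M p \<theta> *v v))) \<and>
     (\<forall>i j. smooth_on \<Theta> (\<lambda>\<theta>. fisher_info M p \<theta> $ i $ j))"

text \<open>
  Since the total mass is constantly \<open>1\<close>, the interchange condition yields that the partial
  derivatives integrate to \<open>0\<close>.
\<close>

lemma regular_family_integral_partial:
  fixes p :: "real^'k::finite \<Rightarrow> 'a \<Rightarrow> real"
  assumes "regular_family M \<Theta> p" "\<theta> \<in> \<Theta>"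
  shows "(\<integral>x. partial i (\<lambda>\<eta>. p \<eta> x) \<theta> \<partial>M) = 0"
proof -
  define F where "F = (\<lambda>t. \<integral>x. p (\<theta> + t *\<^sub>R axis i 1) x \<partial>M)"
  have D: "(F has_real_derivative (\<integral>x. partial i (\<lambda>\<eta>. p \<eta> x) \<theta> \<partial>M)) (at 0)"
    using assms unfolding regular_family_def F_def by blast
  have "((\<lambda>t::real. \<theta> + t *\<^sub>R axis i 1) \<longlongrightarrow> \<theta> + 0 *\<^sub>R axis i 1) (nhds 0)"
    by (intro tendsto_intros filterlim_ident)
  then have "eventually (\<lambda>t. \<theta> + t *\<^sub>R axis i 1 \<in> \<Theta>) (nhds 0)"
    using assms by (auto simp: regular_family_def dest: topological_tendstoD)
  then have "eventually (\<lambda>t. F t = 1) (nhds 0)"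
    by eventually_elim
      (use assms in \<open>auto simp: F_def regular_family_def prob_density_def
        has_bochner_integral_integral_eq\<close>)
  then have "(F has_real_derivative 0) (at 0)"
    using DERIV_cong_ev[of 0 0 F "\<lambda>_. 1" 0 0] by simp
  with D show ?thesis
    by (rule DERIV_unique)
qed

text \<open>
  The metric \<open>g\<close> carried by the family is a parameter: it is \<open>fisher_info M p\<close> for a regular
  family and the block-diagonal metric for a product family.
\<close>

definition rao_dist ::
    "(real^'k) set \<Rightarrow> (real^'k \<Rightarrow> 'a \<Rightarrow> real) \<Rightarrow> (real^'k \<Rightarrow> real^'k^'k) \<Rightarrow>
     ('a \<Rightarrow> real) \<Rightarrow> ('a \<Rightarrow> real) \<Rightarrow> real" where
  "rao_dist \<Theta> p g f h =
     riemannian_dist \<Theta> g (the_inv_into \<Theta> p f) (the_inv_into \<Theta> p h)"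

definition rao_private ::
    "'x set \<Rightarrow> nat \<Rightarrow> (real^'k) set \<Rightarrow> (real^'k \<Rightarrow> 'a \<Rightarrow> real) \<Rightarrow> (real^'k \<Rightarrow> real^'k^'k) \<Rightarrow>
     real \<Rightarrow> ('x list \<Rightarrow> 'a \<Rightarrow> real) \<Rightarrow> bool" where
  "rao_private X n \<Theta> p g \<epsilon> f \<longleftrightarrow>
     (\<forall>D\<in>datasets X n. f D \<in> p ` \<Theta>) \<and>
     (\<forall>D\<in>datasets X n. \<forall>D'\<in>datasets X n.
        adjacent D D' \<longrightarrow> rao_dist \<Theta> p g (f D) (f D') \<le> \<epsilon>)"

text \<open>
  The product of parameter spaces in \<open>real^'k\<close> and \<open>real^'l\<close> lives in \<open>real^('k + 'l)\<close>, whose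
  coordinates are those of the two factors.
\<close>

definition fst_param :: "real^('k::finite + 'l::finite) \<Rightarrow> real^'k" where
  "fst_param \<theta> = (\<chi> i. \<theta> $ Inl i)"

definition snd_param :: "real^('k::finite + 'l::finite) \<Rightarrow> real^'l" where
  "snd_param \<theta> = (\<chi> i. \<theta> $ Inr i)"

definition prod_params :: "(real^'k) set \<Rightarrow> (real^'l) set \<Rightarrow>
    (real^('k::finite + 'l::finite)) set" where
  "prod_params \<Theta>1 \<Theta>2 = {\<theta>. fst_param \<theta> \<in> \<Theta>1 \<and> snd_param \<theta> \<in> \<Theta>2}"

definition prod_dens :: "('a \<Rightarrow> real) \<Rightarrow> ('b \<Rightarrow> real) \<Rightarrow> 'a \<times> 'b \<Rightarrow> real" where
  "prod_dens f h = (\<lambda>(x, y). f x * h y)"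

definition prod_family ::
    "(real^'k \<Rightarrow> 'a \<Rightarrow> real) \<Rightarrow> (real^'l \<Rightarrow> 'b \<Rightarrow> real) \<Rightarrow>
     real^('k::finite + 'l::finite) \<Rightarrow> 'a \<times> 'b \<Rightarrow> real" where
  "prod_family p1 p2 \<theta> = prod_dens (p1 (fst_param \<theta>)) (p2 (snd_param \<theta>))"

definition block_diag :: "real^'k^'k \<Rightarrow> real^'l^'l \<Rightarrow> real^('k::finite + 'l::finite)^('k + 'l)" where
  "block_diag A B = (\<chi> i j. case (i, j) of
       (Inl a, Inl b) \<Rightarrow> A $ a $ b
     | (Inr a, Inr b) \<Rightarrow> B $ a $ b
     | _ \<Rightarrow> 0)"

definition block_diag_metric ::
    "(real^'k \<Rightarrow> real^'k^'k) \<Rightarrow> (real^'l \<Rightarrow> real^'l^'l) \<Rightarrow>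
     real^('k::finite + 'l::finite) \<Rightarrow> real^('k::finite + 'l::finite)^('k + 'l)" where
  "block_diag_metric g1 g2 \<theta> = block_diag (g1 (fst_param \<theta>)) (g2 (snd_param \<theta>))"

end

theory Submission
  imports Defs
begin

text \<open>
  Given paths of lengths less than \<open>L1\<close> and \<open>L2\<close> in the factors, reparametrize each one smoothly
  so that its speed stays below \<open>L1\<close> resp. \<open>L2\<close>. By the block-diagonal form of the metric, the
  squared speed of the combined path is the sum of the squared speeds, so its length is at most
  \<open>sqrt (L1\<^sup>2 + L2\<^sup>2)\<close>. Letting \<open>L1\<close> and \<open>L2\<close> decrease to the distances in the factors gives the
  claim.
\<close>

subsection \<open>Smooth functions on compact intervals\<close>

text \<open>If arbitrary paths with speeds s1, s2 are combined, the length is the integral of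
  sqrt(s1^2 + s2^2). By Minkowski this is at least the root of the sum of the squared lengths, and
  it can come close to the plain sum when one factor moves while the other rests. Bounds on the two
  lengths therefore do not suffice; bounds on both speeds at every time do. A shortest path need not
  exist, since the metric need not be complete, so the bounds \<open>L1\<close>, \<open>L2\<close>
  lie strictly above the distances; the slack also pays for the smooth reparametrization. The new
  parameter is the inverse of an integral, and its smoothness up to the end points comes from the
  differential equation that it solves.\<close>

lemma Ck_on_cong:
  assumes "Ck_on n S f" "\<And>x. x \<in> S \<Longrightarrow> f x = g x"
  shows "Ck_on n S g"
  using assms
proof (induction n arbitrary: f g)
  case 0
  then show ?case by (simp cong: continuous_on_cong)
next
  case (Suc n)
  have *: "(f has_derivative f') (at x within S) \<longleftrightarrow> (g has_derivative f') (at x within S)"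
    if "x \<in> S" for x f'
    using that Suc.prems(2) by (metis has_derivative_transform)
  \<comment> \<open>\<open>frechet_derivative\<close> is chosen by \<open>SOME\<close> from a
    predicate that is equivalent for \<open>f\<close> and \<open>g\<close>, so the choices agree
    even where derivatives are not unique.\<close>
  then have "frechet_derivative f (at x within S) = frechet_derivative g (at x within S)"
    if "x \<in> S" for x
    using that by (simp add: frechet_derivative_def)
  then have "Ck_on n S (\<lambda>x. frechet_derivative g (at x within S) v)" for v
    using Suc.prems(1) Suc.IH[of "\<lambda>x. frechet_derivative f (at x within S) v"] by simp
  moreover have "g differentiable_on S"
    using Suc.prems(1) * by (simp add: differentiable_on_def differentiable_def)
  ultimately show ?case by simp
qed

lemma frechet_derivative_within_Icc:
  fixes f :: "real \<Rightarrow> 'b::real_normed_vector"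
  assumes "a < b" "t \<in> {a..b}" "(f has_derivative f') (at t within {a..b})"
  shows "frechet_derivative f (at t within {a..b}) = f'"
  using frechet_derivative_within_cbox[of a b t f f'] assms by simp

text \<open>Precedes the general product rule because the reduction from all directions
  \<open>v\<close> to the direction 1 multiplies a derivative by the constant
  \<open>v\<close>.\<close>

lemma Ck_on_const_scaleR:
  fixes f :: "real \<Rightarrow> 'b::real_normed_vector"
  assumes "a < b" "Ck_on n {a..b} f"
  shows "Ck_on n {a..b} (\<lambda>x. c *\<^sub>R f x)"
  using assms(2)
proof (induction n arbitrary: f)
  case 0
  then show ?case by (simp add: continuous_on_scaleR)
next
  case (Suc n)
  let ?D = "\<lambda>f t. frechet_derivative f (at t within {a..b})"
  have D: "((\<lambda>x. c *\<^sub>R f x) has_derivative (\<lambda>v. c *\<^sub>R ?D f t v)) (at t within {a..b})"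
    if "t \<in> {a..b}" for t
    using that Suc.prems
    by (intro has_derivative_scaleR_right) (simp add: differentiable_on_def frechet_derivative_works)
  have "Ck_on n {a..b} (\<lambda>t. ?D (\<lambda>x. c *\<^sub>R f x) t v)" for v
  proof (rule Ck_on_cong)
    show "Ck_on n {a..b} (\<lambda>t. c *\<^sub>R ?D f t v)"
      using Suc by auto
  qed (simp add: frechet_derivative_within_Icc[OF \<open>a < b\<close> _ D])
  moreover have "(\<lambda>x. c *\<^sub>R f x) differentiable_on {a..b}"
    using D unfolding differentiable_on_def differentiable_def by blast
  ultimately show ?case by simp
qed

text \<open>A linear map on the reals is determined by its value at 1, so the quantifier over
  directions in \<open>Ck_on\<close> collapses to a single vector derivative. The closure properties
  below induct along this form.\<close>

lemma Ck_on_Suc_Icc_iff: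
  fixes f :: "real \<Rightarrow> 'b::real_normed_vector"
  assumes "a < b"
  shows "Ck_on (Suc n) {a..b} f \<longleftrightarrow>
    (\<exists>f'. (\<forall>t\<in>{a..b}. (f has_vector_derivative f' t) (at t within {a..b})) \<and> Ck_on n {a..b} f')"
    (is "?L \<longleftrightarrow> ?R")
proof
  assume L: ?L
  have "(f has_vector_derivative frechet_derivative f (at t within {a..b}) 1) (at t within {a..b})"
    if "t \<in> {a..b}" for t
  proof -
    have D: "(f has_derivative frechet_derivative f (at t within {a..b})) (at t within {a..b})"
      using L that by (simp add: differentiable_on_def frechet_derivative_works)
    then interpret D: bounded_linear "frechet_derivative f (at t within {a..b})"
      by (rule has_derivative_bounded_linear)
    have "frechet_derivative f (at t within {a..b}) =
        (\<lambda>v. v *\<^sub>R frechet_derivative f (at t within {a..b}) 1)"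
      by (rule ext) (metis D.scaleR mult.right_neutral real_scaleR_def)
    then show ?thesis
      using D by (simp add: has_vector_derivative_def)
  qed
  moreover have "Ck_on n {a..b} (\<lambda>t. frechet_derivative f (at t within {a..b}) 1)"
    using L by simp
  ultimately show ?R
    by (intro exI[of _ "\<lambda>t. frechet_derivative f (at t within {a..b}) 1"]) blast
next
  assume ?R
  then obtain f' where
    D: "\<And>t. t \<in> {a..b} \<Longrightarrow> (f has_vector_derivative f' t) (at t within {a..b})"
    and C: "Ck_on n {a..b} f'"
    by blast
  have "Ck_on n {a..b} (\<lambda>t. frechet_derivative f (at t within {a..b}) v)" for v
  proof (rule Ck_on_cong)
    show "Ck_on n {a..b} (\<lambda>t. v *\<^sub>R f' t)"
      by (rule Ck_on_const_scaleR[OF assms C])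
  qed (simp add: frechet_derivative_within_Icc[OF assms _ D[unfolded has_vector_derivative_def]])
  moreover have "f differentiable_on {a..b}"
    using D unfolding differentiable_on_def differentiable_def has_vector_derivative_def by blast
  ultimately show ?L by simp
qed

lemma Ck_on_SucI:
  fixes f :: "real \<Rightarrow> 'b::real_normed_vector"
  assumes "a < b" "\<And>t. t \<in> {a..b} \<Longrightarrow> (f has_vector_derivative f' t) (at t within {a..b})"
    "Ck_on n {a..b} f'"
  shows "Ck_on (Suc n) {a..b} f"
  unfolding Ck_on_Suc_Icc_iff[OF \<open>a < b\<close>] using assms by blast

lemma Ck_on_SucE:
  fixes f :: "real \<Rightarrow> 'b::real_normed_vector"
  assumes "a < b" "Ck_on (Suc n) {a..b} f"
  obtains f' where "\<And>t. t \<in> {a..b} \<Longrightarrow> (f has_vector_derivative f' t) (at t within {a..b})"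
    "Ck_on n {a..b} f'"
  using assms(2) unfolding Ck_on_Suc_Icc_iff[OF \<open>a < b\<close>] by blast

text \<open>Product and chain rule leave undifferentiated factors in the derivative; these are
  needed at the lower order.\<close>

lemma Ck_on_SucD:
  fixes f :: "real \<Rightarrow> 'b::real_normed_vector"
  assumes "a < b" "Ck_on (Suc n) {a..b} f"
  shows "Ck_on n {a..b} f"
  using assms(2)
proof (induction n arbitrary: f)
  case 0
  then show ?case by (auto intro: differentiable_imp_continuous_on)
next
  case (Suc n)
  from Suc.prems obtain f' where
    "\<And>t. t \<in> {a..b} \<Longrightarrow> (f has_vector_derivative f' t) (at t within {a..b})"
    "Ck_on (Suc n) {a..b} f'"
    by (rule Ck_on_SucE[OF \<open>a < b\<close>]) blast
  then show ?case using Suc.IH \<open>a < b\<close> by (intro Ck_on_SucI) auto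
qed

lemma Ck_on_add:
  fixes f g :: "real \<Rightarrow> 'b::real_normed_vector"
  assumes "a < b" "Ck_on n {a..b} f" "Ck_on n {a..b} g"
  shows "Ck_on n {a..b} (\<lambda>x. f x + g x)"
  using assms(2,3)
proof (induction n arbitrary: f g)
  case 0
  then show ?case by (simp add: continuous_on_add)
next
  case (Suc n)
  from Suc.prems(1) obtain f' where f':
    "\<And>t. t \<in> {a..b} \<Longrightarrow> (f has_vector_derivative f' t) (at t within {a..b})"
    "Ck_on n {a..b} f'"
    by (rule Ck_on_SucE[OF \<open>a < b\<close>]) blast
  from Suc.prems(2) obtain g' where g':
    "\<And>t. t \<in> {a..b} \<Longrightarrow> (g has_vector_derivative g' t) (at t within {a..b})"
    "Ck_on n {a..b} g'"
    by (rule Ck_on_SucE[OF \<open>a < b\<close>]) blast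
  show ?case
    by (rule Ck_on_SucI[OF \<open>a < b\<close> _ Suc.IH[OF f'(2) g'(2)]])
      (intro has_vector_derivative_add f' g')
qed

lemma Ck_on_scaleR:
  fixes f :: "real \<Rightarrow> 'b::real_normed_vector"
  assumes "a < b" "Ck_on n {a..b} \<phi>" "Ck_on n {a..b} f"
  shows "Ck_on n {a..b} (\<lambda>x. \<phi> x *\<^sub>R f x)"
  using assms(2,3)
proof (induction n arbitrary: \<phi> f)
  case 0
  then show ?case by (simp add: continuous_on_scaleR)
next
  case (Suc n)
  from Suc.prems(1) obtain \<phi>' where \<phi>':
    "\<And>t. t \<in> {a..b} \<Longrightarrow> (\<phi> has_vector_derivative \<phi>' t) (at t within {a..b})"
    "Ck_on n {a..b} \<phi>'"
    by (rule Ck_on_SucE[OF \<open>a < b\<close>]) blast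
  from Suc.prems(2) obtain f' where f':
    "\<And>t. t \<in> {a..b} \<Longrightarrow> (f has_vector_derivative f' t) (at t within {a..b})"
    "Ck_on n {a..b} f'"
    by (rule Ck_on_SucE[OF \<open>a < b\<close>]) blast
  show ?case
  proof (rule Ck_on_SucI[OF \<open>a < b\<close>])
    show "Ck_on n {a..b} (\<lambda>t. \<phi> t *\<^sub>R f' t + \<phi>' t *\<^sub>R f t)"
      by (intro Ck_on_add Suc.IH \<phi>' f' \<open>a < b\<close> Suc.prems[THEN Ck_on_SucD[OF \<open>a < b\<close>]])
  qed (intro has_vector_derivative_scaleR f',
      auto simp: has_real_derivative_iff_has_vector_derivative \<phi>')
qed

text \<open>The derivative \<open>\<phi>' t *\<^sub>R f' (\<phi> t)\<close> has the same inner
  function, so the induction generalizes over \<open>f\<close> only.\<close>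

lemma Ck_on_compose:
  fixes \<phi> :: "real \<Rightarrow> real" and f :: "real \<Rightarrow> 'b::real_normed_vector"
  assumes "a < b" "c < d" "Ck_on n {a..b} \<phi>" "\<phi> ` {a..b} \<subseteq> {c..d}" "Ck_on n {c..d} f"
  shows "Ck_on n {a..b} (\<lambda>x. f (\<phi> x))"
  using assms(3-5)
proof (induction n arbitrary: f)
  case 0
  then show ?case
    using continuous_on_compose2[of "{c..d}" f "{a..b}" \<phi>] by simp
next
  case (Suc n)
  from Suc.prems(1) obtain \<phi>' where \<phi>':
    "\<And>t. t \<in> {a..b} \<Longrightarrow> (\<phi> has_vector_derivative \<phi>' t) (at t within {a..b})"
    "Ck_on n {a..b} \<phi>'"
    by (rule Ck_on_SucE[OF \<open>a < b\<close>]) blast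
  from Suc.prems(3) obtain f' where f':
    "\<And>t. t \<in> {c..d} \<Longrightarrow> (f has_vector_derivative f' t) (at t within {c..d})"
    "Ck_on n {c..d} f'"
    by (rule Ck_on_SucE[OF \<open>c < d\<close>]) blast
  show ?case
  proof (rule Ck_on_SucI[OF \<open>a < b\<close>])
    show "Ck_on n {a..b} (\<lambda>t. \<phi>' t *\<^sub>R f' (\<phi> t))"
      by (rule Ck_on_scaleR[OF \<open>a < b\<close> \<phi>'(2) Suc.IH[OF Ck_on_SucD[OF \<open>a < b\<close> Suc.prems(1)] Suc.prems(2) f'(2)]])
    show "((\<lambda>x. f (\<phi> x)) has_vector_derivative \<phi>' t *\<^sub>R f' (\<phi> t)) (at t within {a..b})"
      if t: "t \<in> {a..b}" for t
    proof -
      have "(f has_vector_derivative f' (\<phi> t)) (at (\<phi> t) within \<phi> ` {a..b})"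
        using Suc.prems(2) t by (intro has_vector_derivative_within_subset[OF f'(1)]) blast+
      from vector_diff_chain_within[OF \<phi>'(1)[OF t] this] show ?thesis
        by (simp add: comp_def)
    qed
  qed
qed

text \<open>The derivative of 1/q is -(1/q)^2 q', in which 1/q itself recurs one order lower, as the
  induction hypothesis supplies it.\<close>

lemma Ck_on_inverse:
  fixes q :: "real \<Rightarrow> real"
  assumes "a < b" "Ck_on n {a..b} q" "\<And>t. t \<in> {a..b} \<Longrightarrow> q t \<noteq> 0"
  shows "Ck_on n {a..b} (\<lambda>t. inverse (q t))"
  using assms(2)
proof (induction n)
  case 0
  then show ?case using assms(3) by (simp add: continuous_on_inverse)
next
  case (Suc n)
  from Suc.prems obtain q' where q':
    "\<And>t. t \<in> {a..b} \<Longrightarrow> (q has_vector_derivative q' t) (at t within {a..b})"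
    "Ck_on n {a..b} q'"
    by (rule Ck_on_SucE[OF \<open>a < b\<close>]) blast
  have r: "Ck_on n {a..b} (\<lambda>t. inverse (q t))"
    by (intro Suc.IH Ck_on_SucD[OF \<open>a < b\<close> Suc.prems])
  show ?case
  proof (rule Ck_on_SucI[OF \<open>a < b\<close>])
    show "Ck_on n {a..b} (\<lambda>t. (- 1) *\<^sub>R inverse (q t) *\<^sub>R inverse (q t) *\<^sub>R q' t)"
      using \<open>a < b\<close> r q'(2) by (intro Ck_on_const_scaleR Ck_on_scaleR)
    show "((\<lambda>t. inverse (q t)) has_vector_derivative
        (- 1) *\<^sub>R inverse (q t) *\<^sub>R inverse (q t) *\<^sub>R q' t) (at t within {a..b})"
      if "t \<in> {a..b}" for t
      using q'(1)[OF that] assms(3)[OF that]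
      unfolding has_real_derivative_iff_has_vector_derivative[symmetric]
      by (auto intro!: derivative_eq_intros simp: field_simps)
  qed
qed

lemma Ck_on_polynomial_function:
  fixes f :: "real \<Rightarrow> 'b::euclidean_space"
  assumes "a < b" "polynomial_function f"
  shows "Ck_on n {a..b} f"
  using assms(2)
proof (induction n arbitrary: f)
  case 0
  then show ?case by (simp add: continuous_on_polymonial_function)
next
  case (Suc n)
  then obtain f' where "polynomial_function f'" "\<And>x. (f has_vector_derivative f' x) (at x)"
    using has_vector_derivative_polynomial_function by blast
  then show ?case
    using Suc.IH \<open>a < b\<close> by (intro Ck_on_SucI) (auto intro: has_vector_derivative_at_within)
qed

lemma smooth_on_IccE:
  fixes f :: "real \<Rightarrow> 'b::real_normed_vector"
  assumes "a < b" "smooth_on {a..b} f"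
  obtains f' where "\<And>t. t \<in> {a..b} \<Longrightarrow> (f has_vector_derivative f' t) (at t within {a..b})"
    "continuous_on {a..b} f'"
proof -
  have "Ck_on (Suc 0) {a..b} f"
    using assms(2) unfolding smooth_on_def by blast
  then show ?thesis
    by (rule Ck_on_SucE[OF \<open>a < b\<close>]) (use that in auto)
qed

text \<open>Bootstrapping along the differential equation \<open>\<phi>' = F \<circ> \<phi>\<close>.\<close>

lemma smooth_on_autonomous:
  fixes \<phi> :: "real \<Rightarrow> real"
  assumes "a < b" "c < d" "smooth_on {c..d} F" "\<phi> ` {a..b} \<subseteq> {c..d}"
    and D: "\<And>t. t \<in> {a..b} \<Longrightarrow> (\<phi> has_vector_derivative F (\<phi> t)) (at t within {a..b})"
  shows "smooth_on {a..b} \<phi>"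
proof -
  have "Ck_on n {a..b} \<phi>" for n
  proof (induction n)
    case 0
    show ?case
      using D has_vector_derivative_continuous
      by (simp only: Ck_on.simps continuous_on_eq_continuous_within) blast
  next
    case (Suc n)
    have "Ck_on n {a..b} (\<lambda>t. F (\<phi> t))"
      using assms(3) by (intro Ck_on_compose[OF assms(1,2) Suc assms(4)]) (simp add: smooth_on_def)
    then show ?case using D \<open>a < b\<close> by (intro Ck_on_SucI) auto
  qed
  then show ?thesis by (simp add: smooth_on_def)
qed

subsection \<open>Reparametrization of paths\<close>

text \<open>The difference quotient of \<open>\<phi>\<close> at \<open>u\<close> is the reciprocal
  of that of \<open>\<sigma>\<close> at \<open>\<phi> u\<close>; the left inverse
  \<open>\<sigma>\<close> keeps \<open>\<phi> v\<close> away from \<open>\<phi> u\<close>, so limits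
  compose. Working relative to \<open>S\<close> and \<open>T\<close> covers the end points of an
  interval.\<close>

lemma has_field_derivative_inverse_within:
  fixes \<phi> \<sigma> :: "'a::real_normed_field \<Rightarrow> 'a"
  assumes D: "(\<sigma> has_field_derivative d) (at (\<phi> u) within S)" and "d \<noteq> 0"
    and "u \<in> T" "\<phi> ` T \<subseteq> S" and cont: "continuous (at u within T) \<phi>"
    and inv: "\<And>v. v \<in> T \<Longrightarrow> \<sigma> (\<phi> v) = v"
  shows "(\<phi> has_field_derivative inverse d) (at u within T)"
proof -
  have ev: "\<forall>\<^sub>F v in at u within T. v \<in> T \<and> v \<noteq> u"
    by (simp add: eventually_at_filter)
  have "filterlim \<phi> (at (\<phi> u) within S) (at u within T)"
    unfolding filterlim_at
  proof
    show "\<forall>\<^sub>F v in at u within T. \<phi> v \<in> S \<and> \<phi> v \<noteq> \<phi> u"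
      using ev by eventually_elim (use assms(3,4) inv in \<open>metis image_subset_iff\<close>)
    show "(\<phi> \<longlongrightarrow> \<phi> u) (at u within T)"
      using cont by (simp add: continuous_within)
  qed
  moreover have "((\<lambda>x. (\<sigma> x - \<sigma> (\<phi> u)) / (x - \<phi> u)) \<longlongrightarrow> d) (at (\<phi> u) within S)"
    using D by (simp add: has_field_derivative_iff)
  ultimately have "((\<lambda>v. (\<sigma> (\<phi> v) - \<sigma> (\<phi> u)) / (\<phi> v - \<phi> u)) \<longlongrightarrow> d) (at u within T)"
    by (rule filterlim_compose[rotated])
  then have "((\<lambda>v. inverse ((\<sigma> (\<phi> v) - \<sigma> (\<phi> u)) / (\<phi> v - \<phi> u))) \<longlongrightarrow> inverse d) (at u within T)"
    using \<open>d \<noteq> 0\<close> by (rule tendsto_inverse)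
  moreover have "\<forall>\<^sub>F v in at u within T.
      inverse ((\<sigma> (\<phi> v) - \<sigma> (\<phi> u)) / (\<phi> v - \<phi> u)) = (\<phi> v - \<phi> u) / (v - u)"
    using ev by eventually_elim (use assms(3) inv in auto)
  ultimately show ?thesis
    unfolding has_field_derivative_iff by (rule Lim_transform_eventually)
qed

text \<open>A path with speed \<open>s\<close> has speed \<open>s (\<phi> t) * \<phi>' t\<close>
  after reparametrization. For \<open>q\<close> above \<open>s\<close> with integral
  \<open>Q\<close>, the inverse \<open>\<phi>\<close> of the normalized primitive of
  \<open>q\<close> satisfies \<open>\<phi>' t = Q / q (\<phi> t)\<close>, so the new speed is at
  most \<open>Q\<close>.\<close>

lemma smooth_reparametrization:
  fixes s :: "real \<Rightarrow> real"
  assumes cs: "continuous_on {0..1} s" and s0: "\<And>t. t \<in> {0..1} \<Longrightarrow> 0 \<le> s t"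
    and L: "integral {0..1} s < L"
  obtains \<phi> \<phi>' where "smooth_on {0..1} \<phi>" "\<phi> ` {0..1} \<subseteq> {0..1}" "\<phi> 0 = 0" "\<phi> 1 = 1"
    "\<And>t. t \<in> {0..1} \<Longrightarrow> (\<phi> has_vector_derivative \<phi>' t) (at t within {0..1})"
    "\<And>t. t \<in> {0..1} \<Longrightarrow> 0 \<le> \<phi>' t"
    "\<And>t. t \<in> {0..1} \<Longrightarrow> s (\<phi> t) * \<phi>' t \<le> L"
proof -
  \<comment> \<open>Half the gap: \<open>q\<close> will lie between \<open>s\<close> and
    \<open>s + 2 * e\<close>, so its integral is at most \<open>L\<close>.\<close>
  define e where "e = (L - integral {0..1} s) / 2"
  have "e > 0" using L by (simp add: e_def)
  \<comment> \<open>Approximating the shifted function within \<open>e\<close> keeps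
    \<open>q\<close> strictly above \<open>s\<close>, hence positive even where the speed
    vanishes.\<close>
  have "continuous_on {0..1} (\<lambda>t. s t + e)"
    by (intro continuous_on_add cs continuous_on_const)
  then obtain q where q: "real_polynomial_function q"
    and qe: "\<And>t. t \<in> {0..1} \<Longrightarrow> \<bar>(s t + e) - q t\<bar> < e"
    using Stone_Weierstrass_real_polynomial_function[of "{0..1::real}" "\<lambda>t. s t + e" e] \<open>e > 0\<close>
    by auto
  have sq: "s t < q t" and qs: "q t \<le> s t + 2 * e" if "t \<in> {0..1}" for t
    using qe[OF that] by linarith+
  have q0: "0 < q t" if "t \<in> {0..1}" for t
    using s0[OF that] sq[OF that] by linarith
  have qp: "polynomial_function q"
    using q by (simp add: real_polynomial_function_eq)
  then have cq: "continuous_on S q" for S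
    by (rule continuous_on_polymonial_function)
  define Q where "Q = integral {0..1} q"
  have "Q \<le> integral {0..1} (\<lambda>t. s t + 2 * e)"
    unfolding Q_def
    by (intro integral_le integrable_continuous_real cq qs continuous_on_add cs continuous_on_const)
  also have "\<dots> = integral {0..1} s + 2 * e"
    by (subst integral_add) (auto intro: integrable_continuous_real cs)
  finally have QL: "Q \<le> L"
    by (simp add: e_def field_simps)
  define I where "I = (\<lambda>t. integral {0..t} q)"
  have DI: "(I has_real_derivative q t) (at t within {0..1})" if "t \<in> {0..1}" for t
    unfolding I_def by (rule integral_has_real_derivative[OF cq that])
  have cI: "continuous_on {0..1} I"
    using DI DERIV_continuous unfolding continuous_on_eq_continuous_within by blast
  have mono: "I x < I y" if "0 \<le> x" "x < y" "y \<le> 1" for x y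
  proof (rule DERIV_pos_imp_increasing_open[OF that(2)])
    show "continuous_on {x..y} I"
      using cI that by (auto intro: continuous_on_subset)
    show "\<exists>d. DERIV I t :> d \<and> 0 < d" if "x < t" "t < y" for t
      using DI[of t] q0[of t] that \<open>0 \<le> x\<close> \<open>y \<le> 1\<close> at_within_Icc_at[of 0 t 1] by auto
  qed
  have I0: "I 0 = 0" and I1: "I 1 = Q"
    by (simp_all add: I_def Q_def)
  have "Q > 0" using mono[of 0 1] I0 I1 by simp
  define \<sigma> where "\<sigma> = (\<lambda>t. I t / Q)"
  have \<sigma>0: "\<sigma> 0 = 0" and \<sigma>1: "\<sigma> 1 = 1"
    using I0 I1 \<open>Q > 0\<close> by (simp_all add: \<sigma>_def)
  have c\<sigma>: "continuous_on {0..1} \<sigma>"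
    unfolding \<sigma>_def using \<open>Q > 0\<close> by (intro continuous_on_divide cI continuous_on_const) auto
  have inj: "inj_on \<sigma> {0..1}"
    using \<open>Q > 0\<close> by (intro linorder_inj_onI') (use mono in \<open>force simp: \<sigma>_def\<close>)
  have surj: "{0..1} \<subseteq> \<sigma> ` {0..1}"
  proof
    fix u :: real assume "u \<in> {0..1}"
    then show "u \<in> \<sigma> ` {0..1}"
      using IVT'[OF _ _ _ c\<sigma>, of u] \<sigma>0 \<sigma>1 by force
  qed
  define \<phi> where "\<phi> = the_inv_into {0..1} \<sigma>"
  have \<phi>\<sigma>: "\<phi> (\<sigma> t) = t" if "t \<in> {0..1}" for t
    unfolding \<phi>_def using inj that by (rule the_inv_into_f_f)
  have \<sigma>\<phi>: "\<sigma> (\<phi> u) = u" if "u \<in> {0..1}" for u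
    unfolding \<phi>_def using inj that surj by (intro f_the_inv_into_f) auto
  have range: "\<phi> ` {0..1} \<subseteq> {0..1}"
    using the_inv_into_into[OF inj _ subset_refl] surj unfolding \<phi>_def by blast
  have c\<phi>: "continuous_on {0..1} \<phi>"
    by (rule continuous_on_subset[OF continuous_on_inv[OF c\<sigma> compact_Icc] surj]) (simp add: \<phi>\<sigma>)
  \<comment> \<open>The right-hand side of the equation solved by \<open>\<phi>\<close>. It is
    smooth because \<open>q\<close> is a polynomial without zeros on the interval.\<close>
  define F where "F = (\<lambda>t. Q *\<^sub>R inverse (q t))"
  have D\<phi>: "(\<phi> has_vector_derivative F (\<phi> t)) (at t within {0..1})" if t: "t \<in> {0..1}" for t
  proof -
    have \<phi>t: "\<phi> t \<in> {0..1}" using range t by blast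
    have "(\<phi> has_field_derivative inverse (q (\<phi> t) / Q)) (at t within {0..1})"
    proof (rule has_field_derivative_inverse_within[where S = "{0..1}" and \<sigma> = \<sigma>])
      show "(\<sigma> has_real_derivative q (\<phi> t) / Q) (at (\<phi> t) within {0..1})"
        unfolding \<sigma>_def using DI[OF \<phi>t] by (rule DERIV_cdivide)
      show "q (\<phi> t) / Q \<noteq> 0"
        using q0[OF \<phi>t] \<open>Q > 0\<close> by simp
      show "continuous (at t within {0..1}) \<phi>"
        using c\<phi> t by (simp add: continuous_on_eq_continuous_within)
    qed (use t range \<sigma>\<phi> in auto)
    then show ?thesis
      by (simp add: F_def has_real_derivative_iff_has_vector_derivative divide_inverse mult.commute)
  qed
  have "smooth_on {0..1} F"
    unfolding smooth_on_def F_def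
    by (intro allI Ck_on_const_scaleR Ck_on_inverse Ck_on_polynomial_function qp)
      (use q0 in force)+
  then have "smooth_on {0..1} \<phi>"
    by (rule smooth_on_autonomous[OF zero_less_one zero_less_one _ range D\<phi>])
  moreover have "0 \<le> F (\<phi> t)" "s (\<phi> t) * F (\<phi> t) \<le> L" if "t \<in> {0..1}" for t
  proof -
    have \<phi>t: "\<phi> t \<in> {0..1}" using range that by blast
    show "0 \<le> F (\<phi> t)"
      using q0[OF \<phi>t] \<open>Q > 0\<close> by (simp add: F_def)
    have "s (\<phi> t) * F (\<phi> t) \<le> q (\<phi> t) * F (\<phi> t)"
      using \<open>0 \<le> F (\<phi> t)\<close> sq[OF \<phi>t] by (intro mult_right_mono) auto
    also have "\<dots> = Q"
      using q0[OF \<phi>t] by (simp add: F_def)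
    finally show "s (\<phi> t) * F (\<phi> t) \<le> L"
      using QL by simp
  qed
  moreover have "\<phi> 0 = 0" "\<phi> 1 = 1"
    using \<phi>\<sigma>[of 0] \<phi>\<sigma>[of 1] \<sigma>0 \<sigma>1 by auto
  ultimately show ?thesis
    using that[of \<phi> "\<lambda>t. F (\<phi> t)"] range D\<phi> by blast
qed

section \<open>Speed, length and distance for a metric given by matrices\<close>

definition quad_form :: "real^'n^'n \<Rightarrow> real^'n \<Rightarrow> real" where
  "quad_form A v = (\<Sum>i\<in>UNIV. \<Sum>j\<in>UNIV. A $ i $ j * v $ i * v $ j)"

lemma quad_form_eq_inner: "quad_form A v = v \<bullet> (A *v v)"
  by (simp add: quad_form_def inner_vec_def matrix_vector_mult_def sum_distrib_left ac_simps)

lemma quad_form_scaleR: "quad_form A (c *\<^sub>R v) = c\<^sup>2 * quad_form A v"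
  by (simp add: quad_form_def sum_distrib_left power2_eq_square ac_simps)

lemma quad_form_zero [simp]: "quad_form A 0 = 0"
  by (simp add: quad_form_def)

lemma riemannian_length_eq:
  assumes "\<And>t. t \<in> {0..1} \<Longrightarrow> (\<alpha> has_vector_derivative \<alpha>' t) (at t within {0..1})"
  shows "riemannian_length g \<alpha> = integral {0..1} (\<lambda>t. sqrt (quad_form (g (\<alpha> t)) (\<alpha>' t)))"
  unfolding riemannian_length_def quad_form_def Let_def
  by (intro integral_cong) (simp add: vector_derivative_within_closed_interval[OF zero_less_one _ assms])

lemma riemannian_length_le:
  assumes "\<And>t. t \<in> {0..1} \<Longrightarrow> (\<alpha> has_vector_derivative \<alpha>' t) (at t within {0..1})"
    and "\<And>t. t \<in> {0..1} \<Longrightarrow> sqrt (quad_form (g (\<alpha> t)) (\<alpha>' t)) \<le> L" and "0 \<le> L"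
  shows "riemannian_length g \<alpha> \<le> L"
proof (cases "(\<lambda>t. sqrt (quad_form (g (\<alpha> t)) (\<alpha>' t))) integrable_on {0..1}")
  case True
  have "riemannian_length g \<alpha> = integral {0..1} (\<lambda>t. sqrt (quad_form (g (\<alpha> t)) (\<alpha>' t)))"
    by (rule riemannian_length_eq) (rule assms(1))
  also have "\<dots> \<le> integral {0..1} (\<lambda>_::real. L)"
    by (intro integral_le True assms(2)) auto
  finally show ?thesis by simp
next
  \<comment> \<open>A non-integrable speed has \<open>integral\<close> 0 by convention, hence the
    assumption \<open>0 \<le> L\<close>. This spares a continuity proof for the combined
    speed.\<close>
  case False
  then show ?thesis
    using riemannian_length_eq[OF assms(1), of g] assms(3) by (simp add: not_integrable_integral)
qed

lemma riemannian_length_nonneg: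
  assumes "\<alpha> \<in> smooth_paths \<Theta> a b" and "\<And>x v. x \<in> \<Theta> \<Longrightarrow> 0 \<le> quad_form (g x) v"
  shows "0 \<le> riemannian_length g \<alpha>"
proof -
  let ?f = "\<lambda>t. sqrt (quad_form (g (\<alpha> t)) (vector_derivative \<alpha> (at t within {0..1})))"
  have "riemannian_length g \<alpha> = integral {0..1} ?f"
    by (simp add: riemannian_length_def quad_form_def Let_def)
  moreover have "0 \<le> integral {0..1} ?f"
    using assms
    by (cases "?f integrable_on {0..1}")
      (auto simp: smooth_paths_def not_integrable_integral image_subset_iff
        intro!: Henstock_Kurzweil_Integration.integral_nonneg)
  ultimately show ?thesis by simp
qed

text \<open>Points of a connected open set are joined by polynomial paths. A real \<open>INF\<close>
  can be compared with a bound only over a nonempty set that is bounded below.\<close>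

lemma smooth_paths_nonempty:
  assumes "open \<Theta>" "connected \<Theta>" "a \<in> \<Theta>" "b \<in> \<Theta>"
  shows "smooth_paths \<Theta> a b \<noteq> {}"
proof -
  obtain g where "polynomial_function g" "path_image g \<subseteq> \<Theta>" "pathstart g = a" "pathfinish g = b"
    using connected_open_polynomial_connected[OF assms] by blast
  then have "g \<in> smooth_paths \<Theta> a b"
    by (simp add: smooth_paths_def smooth_on_def Ck_on_polynomial_function path_image_def
        pathstart_def pathfinish_def)
  then show ?thesis by blast
qed

lemma bdd_below_riemannian_length:
  assumes "\<And>x v. x \<in> \<Theta> \<Longrightarrow> 0 \<le> quad_form (g x) v"
  shows "bdd_below (riemannian_length g ` smooth_paths \<Theta> a b)"
  using assms by (intro bdd_belowI2[of _ 0]) (rule riemannian_length_nonneg)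

lemma continuous_on_speed:
  assumes "continuous_on T \<alpha>" "continuous_on T \<alpha>'" "\<alpha> ` T \<subseteq> \<Theta>"
    and g: "\<And>i j. continuous_on \<Theta> (\<lambda>x. g x $ i $ j)"
  shows "continuous_on T (\<lambda>t. sqrt (quad_form (g (\<alpha> t)) (\<alpha>' t)))"
  unfolding quad_form_def
  by (intro continuous_on_real_sqrt continuous_on_sum continuous_on_mult
      continuous_on_compose2[OF g assms(1,3)] continuous_on_component assms(2))

text \<open>
  The speed of a smooth path is continuous but need be neither smooth nor nonzero, so arc length
  need not be a smooth parameter. Reparametrizing by a polynomial slightly above the speed avoids
  this.
\<close>

lemma path_with_bounded_speed:
  assumes "open \<Theta>" "connected \<Theta>" "a \<in> \<Theta>" "b \<in> \<Theta>"
    and g: "\<And>i j. continuous_on \<Theta> (\<lambda>x. g x $ i $ j)"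
    and psd: "\<And>x v. x \<in> \<Theta> \<Longrightarrow> 0 \<le> quad_form (g x) v"
    and L: "riemannian_dist \<Theta> g a b < L"
  obtains \<beta> \<beta>' where "\<beta> \<in> smooth_paths \<Theta> a b"
    "\<And>t. t \<in> {0..1} \<Longrightarrow> (\<beta> has_vector_derivative \<beta>' t) (at t within {0..1})"
    "\<And>t. t \<in> {0..1} \<Longrightarrow> sqrt (quad_form (g (\<beta> t)) (\<beta>' t)) \<le> L"
proof -
  \<comment> \<open>Since \<open>L\<close> lies strictly above the infimum, some path is shorter
    than \<open>L\<close>, whether or not the infimum is attained.\<close>
  obtain \<alpha> where \<alpha>: "\<alpha> \<in> smooth_paths \<Theta> a b" and \<alpha>L: "riemannian_length g \<alpha> < L"
    using L cINF_less_iff[OF smooth_paths_nonempty[OF assms(1-4)] bdd_below_riemannian_length[of \<Theta> g]]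
      psd by (auto simp: riemannian_dist_def)
  have sm: "smooth_on {0..1} \<alpha>" and im: "\<alpha> ` {0..1} \<subseteq> \<Theta>" and "\<alpha> 0 = a" "\<alpha> 1 = b"
    using \<alpha> by (auto simp: smooth_paths_def)
  from sm obtain \<alpha>' where
    D: "\<And>t. t \<in> {0..1} \<Longrightarrow> (\<alpha> has_vector_derivative \<alpha>' t) (at t within {0..1})"
    and c': "continuous_on {0..1} \<alpha>'"
    by (rule smooth_on_IccE[OF zero_less_one]) blast
  have "Ck_on 0 {0..1} \<alpha>"
    using sm unfolding smooth_on_def by blast
  then have c: "continuous_on {0..1} \<alpha>" by simp
  define s where "s = (\<lambda>t. sqrt (quad_form (g (\<alpha> t)) (\<alpha>' t)))"
  have "continuous_on {0..1} s"
    unfolding s_def by (rule continuous_on_speed[OF c c' im g])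
  moreover have "0 \<le> s t" if "t \<in> {0..1}" for t
    using psd im that by (simp add: s_def image_subset_iff)
  moreover have "integral {0..1} s < L"
    using \<alpha>L riemannian_length_eq[OF D, of g] by (simp add: s_def)
  ultimately obtain \<phi> \<phi>' where \<phi>: "smooth_on {0..1} \<phi>" "\<phi> ` {0..1} \<subseteq> {0..1}" "\<phi> 0 = 0" "\<phi> 1 = 1"
    and D\<phi>: "\<And>t. t \<in> {0..1} \<Longrightarrow> (\<phi> has_vector_derivative \<phi>' t) (at t within {0..1})"
    and \<phi>'0: "\<And>t. t \<in> {0..1} \<Longrightarrow> 0 \<le> \<phi>' t"
    and \<phi>'L: "\<And>t. t \<in> {0..1} \<Longrightarrow> s (\<phi> t) * \<phi>' t \<le> L"
    by (rule smooth_reparametrization) (assumption | rule that)+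
  show ?thesis
  proof
    show "(\<lambda>t. \<alpha> (\<phi> t)) \<in> smooth_paths \<Theta> a b"
      using \<phi> sm im \<open>\<alpha> 0 = a\<close> \<open>\<alpha> 1 = b\<close>
        Ck_on_compose[OF zero_less_one zero_less_one _ \<phi>(2), where f = \<alpha>]
      by (simp add: smooth_paths_def smooth_on_def image_subset_iff)
  next
    fix t :: real assume t: "t \<in> {0..1}"
    have "(\<alpha> has_vector_derivative \<alpha>' (\<phi> t)) (at (\<phi> t) within \<phi> ` {0..1})"
      using \<phi>(2) t by (intro has_vector_derivative_within_subset[OF D]) blast+
    from vector_diff_chain_within[OF D\<phi>[OF t] this]
    show "((\<lambda>t. \<alpha> (\<phi> t)) has_vector_derivative \<phi>' t *\<^sub>R \<alpha>' (\<phi> t)) (at t within {0..1})"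
      by (simp add: comp_def)
    \<comment> \<open>The root of the square of \<open>\<phi>' t\<close> is its absolute value;
      monotonicity of \<open>\<phi>\<close> removes the bars.\<close>
    show "sqrt (quad_form (g (\<alpha> (\<phi> t))) (\<phi>' t *\<^sub>R \<alpha>' (\<phi> t))) \<le> L"
      using \<phi>'L[OF t] \<phi>'0[OF t] by (simp add: quad_form_scaleR real_sqrt_mult s_def mult.commute)
  qed
qed

subsection \<open>Product metrics and product families\<close>

definition join_param :: "real^'k \<Rightarrow> real^'l \<Rightarrow> real^('k::finite + 'l::finite)" where
  "join_param x y = (\<chi> i. case i of Inl a \<Rightarrow> x $ a | Inr b \<Rightarrow> y $ b)"

lemma fst_param_join [simp]: "fst_param (join_param x y) = x"
  by (simp add: fst_param_def join_param_def vec_eq_iff)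

lemma snd_param_join [simp]: "snd_param (join_param x y) = y"
  by (simp add: snd_param_def join_param_def vec_eq_iff)

lemma join_param_fst_snd [simp]: "join_param (fst_param z) (snd_param z) = z"
  by (simp add: fst_param_def snd_param_def join_param_def vec_eq_iff split: sum.split)

text \<open>Uncurried, so that continuity and derivatives of pairs carry over to joined
  paths.\<close>

lemma bounded_linear_join_param: "bounded_linear (\<lambda>(x, y). join_param x y)"
  unfolding linear_conv_bounded_linear[symmetric]
  by (rule linearI) (auto simp: join_param_def vec_eq_iff split: sum.split)

lemma has_vector_derivative_join_param:
  assumes "(f has_vector_derivative f') (at t within S)" "(g has_vector_derivative g') (at t within S)"
  shows "((\<lambda>t. join_param (f t) (g t)) has_vector_derivative join_param f' g') (at t within S)"
  using bounded_linear.has_vector_derivative[OF bounded_linear_join_param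
      has_vector_derivative_Pair[OF assms]] by simp

lemma Ck_on_join_param:
  fixes f :: "real \<Rightarrow> real^'k" and g :: "real \<Rightarrow> real^'l"
  assumes "a < b" "Ck_on n {a..b} f" "Ck_on n {a..b} g"
  shows "Ck_on n {a..b} (\<lambda>t. join_param (f t) (g t))"
  using assms(2,3)
proof (induction n arbitrary: f g)
  case 0
  then have "continuous_on {a..b} (\<lambda>t. (f t, g t))"
    by (simp add: continuous_on_Pair)
  from bounded_linear.continuous_on[OF bounded_linear_join_param this] show ?case by simp
next
  case (Suc n)
  from Suc.prems(1) obtain f' where f':
    "\<And>t. t \<in> {a..b} \<Longrightarrow> (f has_vector_derivative f' t) (at t within {a..b})"
    "Ck_on n {a..b} f'"
    by (rule Ck_on_SucE[OF \<open>a < b\<close>]) blast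
  from Suc.prems(2) obtain g' where g':
    "\<And>t. t \<in> {a..b} \<Longrightarrow> (g has_vector_derivative g' t) (at t within {a..b})"
    "Ck_on n {a..b} g'"
    by (rule Ck_on_SucE[OF \<open>a < b\<close>]) blast
  show ?case
    by (rule Ck_on_SucI[OF \<open>a < b\<close> _ Suc.IH[OF f'(2) g'(2)]])
      (intro has_vector_derivative_join_param f' g')
qed

lemma join_smooth_paths:
  assumes "\<alpha> \<in> smooth_paths \<Theta>1 a1 b1" "\<beta> \<in> smooth_paths \<Theta>2 a2 b2"
  shows "(\<lambda>t. join_param (\<alpha> t) (\<beta> t)) \<in>
    smooth_paths (prod_params \<Theta>1 \<Theta>2) (join_param a1 a2) (join_param b1 b2)"
  using assms
  by (auto simp: smooth_paths_def smooth_on_def prod_params_def image_subset_iff intro!: Ck_on_join_param)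

text \<open>The double sum over the sum type splits into four blocks, of which the two mixed ones
  vanish: Pythagoras for the squared speeds.\<close>

lemma quad_form_block_diag:
  "quad_form (block_diag A B) v = quad_form A (fst_param v) + quad_form B (snd_param v)"
  by (simp add: quad_form_def block_diag_def fst_param_def snd_param_def
      UNIV_Plus_UNIV[symmetric] sum.Plus del: UNIV_Plus_UNIV)

lemma riemannian_dist_block_diag_le:
  assumes \<Theta>1: "open \<Theta>1" "connected \<Theta>1" "a1 \<in> \<Theta>1" "b1 \<in> \<Theta>1"
    and \<Theta>2: "open \<Theta>2" "connected \<Theta>2" "a2 \<in> \<Theta>2" "b2 \<in> \<Theta>2"
    and g1: "\<And>i j. continuous_on \<Theta>1 (\<lambda>x. g1 x $ i $ j)"
    and g2: "\<And>i j. continuous_on \<Theta>2 (\<lambda>x. g2 x $ i $ j)"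
    and psd1: "\<And>x v. x \<in> \<Theta>1 \<Longrightarrow> 0 \<le> quad_form (g1 x) v"
    and psd2: "\<And>x v. x \<in> \<Theta>2 \<Longrightarrow> 0 \<le> quad_form (g2 x) v"
    and d1: "riemannian_dist \<Theta>1 g1 a1 b1 \<le> d1" and d2: "riemannian_dist \<Theta>2 g2 a2 b2 \<le> d2"
  shows "riemannian_dist (prod_params \<Theta>1 \<Theta>2) (block_diag_metric g1 g2)
    (join_param a1 a2) (join_param b1 b2) \<le> sqrt (d1\<^sup>2 + d2\<^sup>2)" (is "?d \<le> _")
proof (rule field_le_epsilon)
  fix e :: real assume "e > 0"
  \<comment> \<open>The shares \<open>e / 2\<close> make the final error at most
    \<open>e\<close>.\<close>
  define L1 where "L1 = d1 + e / 2"
  define L2 where "L2 = d2 + e / 2"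
  have L: "riemannian_dist \<Theta>1 g1 a1 b1 < L1" "riemannian_dist \<Theta>2 g2 a2 b2 < L2"
    using d1 d2 \<open>e > 0\<close> by (auto simp: L1_def L2_def)
  obtain \<beta>1 \<beta>1' where \<beta>1: "\<beta>1 \<in> smooth_paths \<Theta>1 a1 b1"
    and D1: "\<And>t. t \<in> {0..1} \<Longrightarrow> (\<beta>1 has_vector_derivative \<beta>1' t) (at t within {0..1})"
    and s1: "\<And>t. t \<in> {0..1} \<Longrightarrow> sqrt (quad_form (g1 (\<beta>1 t)) (\<beta>1' t)) \<le> L1"
    using path_with_bounded_speed[of \<Theta>1 a1 b1 g1 L1] \<Theta>1 g1 psd1 L(1) by blast
  obtain \<beta>2 \<beta>2' where \<beta>2: "\<beta>2 \<in> smooth_paths \<Theta>2 a2 b2"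
    and D2: "\<And>t. t \<in> {0..1} \<Longrightarrow> (\<beta>2 has_vector_derivative \<beta>2' t) (at t within {0..1})"
    and s2: "\<And>t. t \<in> {0..1} \<Longrightarrow> sqrt (quad_form (g2 (\<beta>2 t)) (\<beta>2' t)) \<le> L2"
    using path_with_bounded_speed[of \<Theta>2 a2 b2 g2 L2] \<Theta>2 g2 psd2 L(2) by blast
  let ?\<gamma> = "\<lambda>t. join_param (\<beta>1 t) (\<beta>2 t)"
  have "?d \<le> riemannian_length (block_diag_metric g1 g2) ?\<gamma>"
    unfolding riemannian_dist_def
  proof (rule cINF_lower[OF bdd_below_riemannian_length join_smooth_paths[OF \<beta>1 \<beta>2]])
    show "0 \<le> quad_form (block_diag_metric g1 g2 x) v" if "x \<in> prod_params \<Theta>1 \<Theta>2" for x v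
      using that psd1 psd2 by (simp add: prod_params_def block_diag_metric_def quad_form_block_diag)
  qed
  also have "\<dots> \<le> sqrt (L1\<^sup>2 + L2\<^sup>2)"
  proof (rule riemannian_length_le)
    fix t :: real assume t: "t \<in> {0..1}"
    show "(?\<gamma> has_vector_derivative join_param (\<beta>1' t) (\<beta>2' t)) (at t within {0..1})"
      by (rule has_vector_derivative_join_param[OF D1[OF t] D2[OF t]])
    have "\<beta>1 t \<in> \<Theta>1" "\<beta>2 t \<in> \<Theta>2"
      using \<beta>1 \<beta>2 t by (simp_all add: smooth_paths_def image_subset_iff)
    \<comment> \<open>Both bounds hold at the same \<open>t\<close>, so they can be squared and
      added under one root.\<close>
    then have "quad_form (g1 (\<beta>1 t)) (\<beta>1' t) \<le> L1\<^sup>2" "quad_form (g2 (\<beta>2 t)) (\<beta>2' t) \<le> L2\<^sup>2"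
      using s1[OF t] s2[OF t] psd1 psd2 by (simp_all add: sqrt_le_D)
    then show "sqrt (quad_form (block_diag_metric g1 g2 (?\<gamma> t)) (join_param (\<beta>1' t) (\<beta>2' t)))
        \<le> sqrt (L1\<^sup>2 + L2\<^sup>2)"
      by (simp add: block_diag_metric_def quad_form_block_diag)
  qed simp
  \<comment> \<open>Triangle inequality in the plane for the vectors (d1, d2) and (e/2,
    e/2).\<close>
  also have "\<dots> \<le> sqrt (d1\<^sup>2 + d2\<^sup>2) + sqrt ((e / 2)\<^sup>2 + (e / 2)\<^sup>2)"
    unfolding L1_def L2_def by (rule real_sqrt_sum_squares_triangle_ineq)
  also have "sqrt ((e / 2)\<^sup>2 + (e / 2)\<^sup>2) \<le> e / 2 + e / 2"
    using \<open>e > 0\<close> by (intro sqrt_sum_squares_le_sum) auto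
  finally show "?d \<le> sqrt (d1\<^sup>2 + d2\<^sup>2) + e" by simp
qed

section \<open>Identification of product densities with pairs of parameters\<close>

text \<open>
  The values of a density outside the space of its measure are arbitrary; integrating out one
  variable of a product determines the other factor there as well.
\<close>

lemma prod_dens_eqD:
  assumes "prob_density M1 p" "prob_density M1 q" "prob_density M2 r" "prob_density M2 s"
    and eq: "prod_dens p r = prod_dens q s"
  shows "p = q" "r = s"
proof -
  have eq: "p x * r y = q x * s y" for x y
    using fun_cong[OF eq, of "(x, y)"] by (simp add: prod_dens_def)
  have int: "integral\<^sup>L M1 p = 1" "integral\<^sup>L M1 q = 1" "integral\<^sup>L M2 r = 1" "integral\<^sup>L M2 s = 1"
    using assms(1-4) by (simp_all add: prob_density_def has_bochner_integral_integral_eq)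
  show "p = q"
  proof
    fix x
    have "(\<integral>y. p x * r y \<partial>M2) = (\<integral>y. q x * s y \<partial>M2)"
      by (simp add: eq)
    then show "p x = q x" by (simp add: int)
  qed
  show "r = s"
  proof
    fix y
    have "(\<integral>x. p x * r y \<partial>M1) = (\<integral>x. q x * s y \<partial>M1)"
      by (simp add: eq)
    then show "r y = s y" by (simp add: int)
  qed
qed

text \<open>A product determines its factors only up to reciprocal constants; total mass 1 fixes
  these. Injectivity lets \<open>the_inv_into\<close> in \<open>rao_dist\<close> recover the
  parameter of a product density.\<close>

lemma inj_on_prod_family:
  assumes "inj_on p1 \<Theta>1" "\<And>x. x \<in> \<Theta>1 \<Longrightarrow> prob_density M1 (p1 x)"
    and "inj_on p2 \<Theta>2" "\<And>x. x \<in> \<Theta>2 \<Longrightarrow> prob_density M2 (p2 x)"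
  shows "inj_on (prod_family p1 p2) (prod_params \<Theta>1 \<Theta>2)"
proof (rule inj_onI)
  fix x y assume xy: "x \<in> prod_params \<Theta>1 \<Theta>2" "y \<in> prod_params \<Theta>1 \<Theta>2"
    and "prod_family p1 p2 x = prod_family p1 p2 y"
  then have "p1 (fst_param x) = p1 (fst_param y)" "p2 (snd_param x) = p2 (snd_param y)"
    using assms(2,4) prod_dens_eqD[of M1 "p1 (fst_param x)" "p1 (fst_param y)"
        M2 "p2 (snd_param x)" "p2 (snd_param y)"]
    by (auto simp: prod_family_def prod_params_def)
  then have "fst_param x = fst_param y" "snd_param x = snd_param y"
    using xy assms(1,3) by (auto simp: prod_params_def inj_on_def)
  then show "x = y"
    by (metis join_param_fst_snd)
qed

lemma regular_family_fisher_info_continuous: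
  assumes "regular_family M \<Theta> p"
  shows "continuous_on \<Theta> (\<lambda>x. fisher_info M p x $ i $ j)"
proof -
  have "Ck_on 0 \<Theta> (\<lambda>x. fisher_info M p x $ i $ j)"
    using assms unfolding regular_family_def smooth_on_def by blast
  then show ?thesis by simp
qed

lemma regular_family_fisher_info_psd:
  assumes "regular_family M \<Theta> p" "x \<in> \<Theta>"
  shows "0 \<le> quad_form (fisher_info M p x) v"
proof (cases "v = 0")
  case False
  then have "0 < v \<bullet> (fisher_info M p x *v v)"
    using assms unfolding regular_family_def by blast
  then show ?thesis by (simp add: quad_form_eq_inner)
qed simp

theorem lemma3p2:
  fixes X :: "'x set" and n :: nat
    and M1 :: "'a measure" and \<Theta>1 :: "(real^'k::finite) set" and p1 :: "real^'k \<Rightarrow> 'a \<Rightarrow> real"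
    and M2 :: "'b measure" and \<Theta>2 :: "(real^'l::finite) set" and p2 :: "real^'l \<Rightarrow> 'b \<Rightarrow> real"
    and f1 :: "'x list \<Rightarrow> 'a \<Rightarrow> real" and f2 :: "'x list \<Rightarrow> 'b \<Rightarrow> real"
    and \<theta>1 \<theta>2 :: real
  assumes "\<theta>1 > 0" and "\<theta>2 > 0"
    and "regular_family M1 \<Theta>1 p1" and "regular_family M2 \<Theta>2 p2"
    and "rao_private X n \<Theta>1 p1 (fisher_info M1 p1) \<theta>1 f1"
    and "rao_private X n \<Theta>2 p2 (fisher_info M2 p2) \<theta>2 f2"
  shows "rao_private X n (prod_params \<Theta>1 \<Theta>2) (prod_family p1 p2)
           (block_diag_metric (fisher_info M1 p1) (fisher_info M2 p2))
           (sqrt (\<theta>1\<^sup>2 + \<theta>2\<^sup>2)) (\<lambda>D. prod_dens (f1 D) (f2 D))"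
proof -
  note r1 = \<open>regular_family M1 \<Theta>1 p1\<close> and r2 = \<open>regular_family M2 \<Theta>2 p2\<close>
  have inj1: "inj_on p1 \<Theta>1" and inj2: "inj_on p2 \<Theta>2"
    using r1 r2 by (auto simp: regular_family_def)
  have oc: "open \<Theta>1" "connected \<Theta>1" "open \<Theta>2" "connected \<Theta>2"
    using r1 r2 by (auto simp: regular_family_def)
  have inj: "inj_on (prod_family p1 p2) (prod_params \<Theta>1 \<Theta>2)"
    using r1 r2 by (intro inj_on_prod_family[where ?M1.0 = M1 and ?M2.0 = M2])
      (auto simp: regular_family_def)
  let ?\<theta> = "\<lambda>D. join_param (the_inv_into \<Theta>1 p1 (f1 D)) (the_inv_into \<Theta>2 p2 (f2 D))"
  have param: "the_inv_into \<Theta>1 p1 (f1 D) \<in> \<Theta>1" "p1 (the_inv_into \<Theta>1 p1 (f1 D)) = f1 D"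
    "the_inv_into \<Theta>2 p2 (f2 D) \<in> \<Theta>2" "p2 (the_inv_into \<Theta>2 p2 (f2 D)) = f2 D"
    if "D \<in> datasets X n" for D
    using that assms(5,6) inj1 inj2
    by (auto simp: rao_private_def intro: the_inv_into_into f_the_inv_into_f)
  have dens: "prod_dens (f1 D) (f2 D) = prod_family p1 p2 (?\<theta> D)" "?\<theta> D \<in> prod_params \<Theta>1 \<Theta>2"
    if "D \<in> datasets X n" for D
    using param[OF that] by (simp_all add: prod_family_def prod_params_def)
  \<comment> \<open>The parameter recovered from the product density is the joined pair, so the
    claim becomes one about \<open>riemannian_dist\<close> between joined points.\<close>
  have inv: "the_inv_into (prod_params \<Theta>1 \<Theta>2) (prod_family p1 p2) (prod_dens (f1 D) (f2 D)) = ?\<theta> D"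
    if "D \<in> datasets X n" for D
    using dens[OF that] inj by (simp add: the_inv_into_f_f)
  show ?thesis
    unfolding rao_private_def
  proof (intro conjI ballI impI)
    fix D assume "D \<in> datasets X n"
    then show "prod_dens (f1 D) (f2 D) \<in> prod_family p1 p2 ` prod_params \<Theta>1 \<Theta>2"
      using dens by blast
  next
    fix D D' assume D: "D \<in> datasets X n" "D' \<in> datasets X n" and "adjacent D D'"
    then have le: "rao_dist \<Theta>1 p1 (fisher_info M1 p1) (f1 D) (f1 D') \<le> \<theta>1"
      "rao_dist \<Theta>2 p2 (fisher_info M2 p2) (f2 D) (f2 D') \<le> \<theta>2"
      using assms(5,6) by (auto simp: rao_private_def)
    show "rao_dist (prod_params \<Theta>1 \<Theta>2) (prod_family p1 p2)
        (block_diag_metric (fisher_info M1 p1) (fisher_info M2 p2))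
        (prod_dens (f1 D) (f2 D)) (prod_dens (f1 D') (f2 D')) \<le> sqrt (\<theta>1\<^sup>2 + \<theta>2\<^sup>2)"
      unfolding rao_dist_def inv[OF D(1)] inv[OF D(2)]
      using oc param[OF D(1)] param[OF D(2)] le[unfolded rao_dist_def]
      by (intro riemannian_dist_block_diag_le regular_family_fisher_info_continuous[OF r1]
          regular_family_fisher_info_continuous[OF r2] regular_family_fisher_info_psd[OF r1]
          regular_family_fisher_info_psd[OF r2])
  qed
qed

end
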